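(* Let $\Omega\subset\mathbb{R}^n$ be a bounded domain with $C^2$ boundary, and let $a^1,\dots,a^n\in C^1(\overline\Omega)$ be such that the diagonal matrix $A=\operatorname{diag}(a^1,\dots,a^n)$ is uniformly positive definite over $\overline\Omega$. Write $a^{ij}=a^i$ if $i=j$ and $a^{ij}=0$ if $i\neq j$. Suppose there exists $j_0\in\{1,\dots,n\}$ such that either $a^i_{x_{j_0}}>0$ on $\overline\Omega$ for all $1\le i\le n$ with $i\ne j_0$, or $a^i_{x_{j_0}}<0$ on $\overline\Omega$ for all $1\le i\le n$ with $i\neq j_0$. Then there exist a function $d\in C^2(\overline\Omega)$ and a constant $\mu_0>0$ such that $$\sum_{i,j=1}^n\bigg\{\sum_{i',j'=1}^n\Big[2a^{ij'}\big(a^{i'j}d_{x_{i'}}\big)_{x_{j'}}-a^{ij}_{x_{j'}}a^{i'j'}d_{x_{i'}}\Big]\bigg\}\xi_i\xi_j\ \ge\ \mu_0\sum_{i,j=1}^n a^{ij}\xi_i\xi_j$$ for all $(x,\xi_1,\dots,\xi_n)\in\overline\Omega\times\mathbb{R}^n$, and $|\nabla d|>0$ in $\overline\Omega$.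
   Context: Subscripts $x_k$ denote partial derivatives with respect to the $k$-th coordinate, e.g. $a^i_{x_k}=\partial a^i/\partial x_k$, $a^{ij}_{x_k}=\partial a^{ij}/\partial x_k$, and $d_{x_k}=\partial d/\partial x_k$. For functions in $C^1(\overline\Omega)$ or $C^2(\overline\Omega)$, derivatives on $\partial\Omega$ are understood as the continuous extensions to $\overline\Omega$. A matrix-valued function $A(x)$ is uniformly positive definite over $\overline\Omega$ if there is a constant $c_0>0$ with $\sum_{i,j}a^{ij}(x)\xi_i\xi_j\ge c_0|\xi|^2$ for all $x\in\overline\Omega$, $\xi\in\mathbb{R}^n$. *)

theory Defs
  imports "HOL-Analysis.Analysis"
begin

text \<open>
  Functions on the closure of an open set are represented by total functions of which only the
  values on the closure matter. On the boundary, a partial derivative is the limit of its values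
  inside the set; it is meaningful there once the derivative extends continuously to the closure,
  which is what \<open>C1_closure\<close> demands.
\<close>

definition pderiv_cl :: "(real^'n) set \<Rightarrow> 'n::finite \<Rightarrow> (real^'n \<Rightarrow> real) \<Rightarrow> real^'n \<Rightarrow> real" where
  "pderiv_cl \<Omega> k u x =
     (if x \<in> \<Omega> then frechet_derivative u (at x) (axis k 1)
      else Lim (at x within \<Omega>) (\<lambda>y. frechet_derivative u (at y) (axis k 1)))"

definition gradient_cl :: "(real^'n) set \<Rightarrow> (real^'n::finite \<Rightarrow> real) \<Rightarrow> real^'n \<Rightarrow> real^'n" where
  "gradient_cl \<Omega> u x = (\<chi> k. pderiv_cl \<Omega> k u x)"

definition C1_closure :: "(real^'n) set \<Rightarrow> (real^'n::finite \<Rightarrow> real) \<Rightarrow> bool" where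
  "C1_closure \<Omega> u \<longleftrightarrow>
     continuous_on (closure \<Omega>) u \<and> (\<forall>x\<in>\<Omega>. u differentiable (at x)) \<and>
     (\<forall>k. continuous_on (closure \<Omega>) (pderiv_cl \<Omega> k u))"

definition C2_closure :: "(real^'n) set \<Rightarrow> (real^'n::finite \<Rightarrow> real) \<Rightarrow> bool" where
  "C2_closure \<Omega> u \<longleftrightarrow> C1_closure \<Omega> u \<and> (\<forall>k. C1_closure \<Omega> (pderiv_cl \<Omega> k u))"

definition domain_set :: "(real^'n::finite) set \<Rightarrow> bool" where
  "domain_set \<Omega> \<longleftrightarrow> open \<Omega> \<and> connected \<Omega> \<and> \<Omega> \<noteq> {}"

text \<open>
  The boundary is of class \<open>C\<^sup>2\<close> if, near each of its points and in suitable Cartesian coordinates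
  \<open>T x\<close>, the set is the region above the graph of a \<open>C\<^sup>2\<close> function of the \<open>n - 1\<close> coordinates other
  than the \<open>k\<close>-th. Such a function is encoded as a function \<open>\<gamma>\<close> on the whole space that does not
  depend on the \<open>k\<close>-th coordinate.
\<close>

definition C2_boundary :: "(real^'n::finite) set \<Rightarrow> bool" where
  "C2_boundary \<Omega> \<longleftrightarrow>
     (\<forall>p\<in>frontier \<Omega>. \<exists>r>0. \<exists>(T :: real^'n \<Rightarrow> real^'n) k \<gamma>.
        orthogonal_transformation T \<and>
        C2_closure UNIV \<gamma> \<and> (\<forall>y t. \<gamma> (y + t *\<^sub>R axis k 1) = \<gamma> y) \<and>
        \<Omega> \<inter> ball p r = {x \<in> ball p r. T x $ k > \<gamma> (T x)})"

definition diag_matrix :: "('n \<Rightarrow> real^'n \<Rightarrow> real) \<Rightarrow> real^'n \<Rightarrow> real^'n::finite^'n" where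
  "diag_matrix a x = (\<chi> i j. if i = j then a i x else 0)"

definition unif_pos_def :: "(real^'n) set \<Rightarrow> (real^'n \<Rightarrow> real^'n::finite^'n) \<Rightarrow> bool" where
  "unif_pos_def S A \<longleftrightarrow>
     (\<exists>c0>0. \<forall>x\<in>S. \<forall>\<xi>. (\<Sum>i\<in>UNIV. \<Sum>j\<in>UNIV. A x $ i $ j * \<xi> $ i * \<xi> $ j) \<ge> c0 * (norm \<xi>)\<^sup>2)"

end

theory Submission
  imports Defs
begin

text \<open>
  Take \<open>d x = exp (s * x\<^sub>k)\<close> with \<open>k = j\<^sub>0\<close> and the sign of \<open>s\<close> opposite to that of the
  derivatives \<open>a\<^sup>i\<^sub>x\<^sub>k\<close> for \<open>i \<noteq> k\<close>. With \<open>F = \<bar>s\<bar> * d\<close> and \<open>\<sigma> = sgn s\<close> the quadratic form equals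
  \<open>F\<close> times the sum of \<open>- \<sigma> * a\<^sup>k * a\<^sup>i\<^sub>x\<^sub>k * \<xi>\<^sub>i\<^sup>2\<close> over \<open>i \<noteq> k\<close>, of the mixed terms
  \<open>2 * \<sigma> * a\<^sup>i * a\<^sup>k\<^sub>x\<^sub>i * \<xi>\<^sub>i * \<xi>\<^sub>k\<close>, and of \<open>(2 * \<bar>s\<bar> * (a\<^sup>k)\<^sup>2 + \<sigma> * a\<^sup>k * a\<^sup>k\<^sub>x\<^sub>k) * \<xi>\<^sub>k\<^sup>2\<close>. The first sum
  is coercive in the variables other than \<open>\<xi>\<^sub>k\<close> by compactness, and for large \<open>\<bar>s\<bar>\<close> the last term
  absorbs the mixed ones.
\<close>

section \<open>Partial derivatives extended to the closure\<close>

lemma pderiv_cl_cong: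
  assumes "open \<Omega>" and eq: "\<And>y. y \<in> \<Omega> \<Longrightarrow> u y = v y"
  shows "pderiv_cl \<Omega> k u x = pderiv_cl \<Omega> k v x"
proof -
  have fd: "frechet_derivative u (at y) = frechet_derivative v (at y)" if "y \<in> \<Omega>" for y
  proof -
    have "(u has_derivative D) (at y) \<longleftrightarrow> (v has_derivative D) (at y)" for D
      using has_derivative_transform_within_open[OF _ assms(1) that] eq by metis
    then show ?thesis by (simp add: frechet_derivative_def)
  qed
  \<comment> \<open>The limit only sees points of \<open>\<Omega>\<close>, so equality there also
    settles the values off \<open>\<Omega>\<close>, whether or not the limits exist.\<close>
  have "((\<lambda>y. frechet_derivative u (at y) (axis k 1)) \<longlongrightarrow> l) (at x within \<Omega>) \<longleftrightarrow>
        ((\<lambda>y. frechet_derivative v (at y) (axis k 1)) \<longlongrightarrow> l) (at x within \<Omega>)" for l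
    by (rule tendsto_cong) (auto simp: eventually_at_filter fd intro!: always_eventually)
  then show ?thesis by (auto simp: pderiv_cl_def fd Topological_Spaces.Lim_def)
qed

text \<open>Computes boundary values: a closure point outside \<open>\<Omega>\<close> is a limit
  point of \<open>\<Omega>\<close>, so the limit defining the derivative is unique, and continuity
  of the formula \<open>h\<close> identifies it.\<close>

lemma pderiv_cl_eqI:
  assumes D: "\<And>y. y \<in> \<Omega> \<Longrightarrow> (u has_derivative D y) (at y)"
    and h: "\<And>y. y \<in> \<Omega> \<Longrightarrow> D y (axis k 1) = h y"
    and cont: "continuous_on (closure \<Omega>) h" and x: "x \<in> closure \<Omega>"
  shows "pderiv_cl \<Omega> k u x = h x"
proof -
  have fd: "frechet_derivative u (at y) (axis k 1) = h y" if "y \<in> \<Omega>" for y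
    using frechet_derivative_at[OF D[OF that]] h[OF that] by simp
  show ?thesis
  proof (cases "x \<in> \<Omega>")
    case True
    then show ?thesis by (simp add: pderiv_cl_def fd)
  next
    case False
    with x have nb: "at x within \<Omega> \<noteq> bot"
      by (auto simp: closure_def trivial_limit_within)
    have "(h \<longlongrightarrow> h x) (at x within \<Omega>)"
      using cont x closure_subset by (auto simp: continuous_on_def intro: tendsto_within_subset)
    then have "((\<lambda>y. frechet_derivative u (at y) (axis k 1)) \<longlongrightarrow> h x) (at x within \<Omega>)"
      by (rule Lim_transform_eventually) (auto simp: eventually_at_filter fd intro!: always_eventually)
    then show ?thesis using False nb by (simp add: pderiv_cl_def tendsto_Lim)
  qed
qed

lemma C1_closureI:
  assumes "continuous_on (closure \<Omega>) u"
    and D: "\<And>y. y \<in> \<Omega> \<Longrightarrow> (u has_derivative D y) (at y)"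
    and h: "\<And>y k. y \<in> \<Omega> \<Longrightarrow> D y (axis k 1) = h k y"
    and cont: "\<And>k. continuous_on (closure \<Omega>) (h k)"
  shows "C1_closure \<Omega> u"
proof -
  have "continuous_on (closure \<Omega>) (pderiv_cl \<Omega> k u)" for k
    by (rule continuous_on_eq[OF cont[of k]]) (rule pderiv_cl_eqI[OF D h cont, symmetric])
  then show ?thesis using assms(1) D by (auto simp: C1_closure_def differentiable_def)
qed

text \<open>Serves to pass to second derivatives, where the explicit formula for a first derivative
  is only known on the closure. Agreement on the boundary is required because continuity of
  \<open>u\<close> up to it is part of the claim.\<close>

lemma C1_closure_cong:
  assumes "open \<Omega>" and eq: "\<And>y. y \<in> closure \<Omega> \<Longrightarrow> u y = v y" and "C1_closure \<Omega> v"
  shows "C1_closure \<Omega> u"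
proof -
  have eq': "u y = v y" if "y \<in> \<Omega>" for y using that eq closure_subset by blast
  have "pderiv_cl \<Omega> k u = pderiv_cl \<Omega> k v" for k
    using pderiv_cl_cong[where u = u and v = v, OF assms(1) eq'] by (intro ext)
  moreover have "u differentiable (at y)" if y: "y \<in> \<Omega>" for y
  proof -
    obtain D where "(v has_derivative D) (at y)"
      using assms(3) y by (auto simp: C1_closure_def differentiable_def)
    from has_derivative_transform_within_open[OF this assms(1) y, of u] show ?thesis
      by (auto simp: eq' differentiable_def)
  qed
  moreover have "continuous_on (closure \<Omega>) u"
    using assms(3) by (intro continuous_on_eq[OF _ eq[symmetric]]) (simp_all add: C1_closure_def)
  ultimately show ?thesis using assms(3) by (simp add: C1_closure_def)
qed

lemma pderiv_cl_zero:
  assumes "x \<in> closure \<Omega>"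
  shows "pderiv_cl \<Omega> k (\<lambda>y. 0) x = 0"
  by (rule pderiv_cl_eqI[where D = "\<lambda>y h. 0"]) (auto simp: assms)

lemma pderiv_cl_mult:
  assumes u: "C1_closure \<Omega> u" and v: "C1_closure \<Omega> v" and x: "x \<in> closure \<Omega>"
  shows "pderiv_cl \<Omega> k (\<lambda>y. u y * v y) x = u x * pderiv_cl \<Omega> k v x + pderiv_cl \<Omega> k u x * v x"
proof (rule pderiv_cl_eqI[OF _ _ _ x])
  fix y assume y: "y \<in> \<Omega>"
  show "((\<lambda>y. u y * v y) has_derivative (\<lambda>h. u y * frechet_derivative v (at y) h +
      frechet_derivative u (at y) h * v y)) (at y)"
    using u v y by (intro has_derivative_mult) (auto simp: C1_closure_def frechet_derivative_works)
  show "u y * frechet_derivative v (at y) (axis k 1) + frechet_derivative u (at y) (axis k 1) * v y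
      = u y * pderiv_cl \<Omega> k v y + pderiv_cl \<Omega> k u y * v y"
    using y by (simp add: pderiv_cl_def)
next
  show "continuous_on (closure \<Omega>) (\<lambda>x. u x * pderiv_cl \<Omega> k v x + pderiv_cl \<Omega> k u x * v x)"
    using u v by (intro continuous_intros) (auto simp: C1_closure_def)
qed

section \<open>The exponential of one coordinate\<close>

lemma has_derivative_exp_nth:
  "((\<lambda>y. c * exp (s * y $ k)) has_derivative (\<lambda>h. c * (exp (s * y $ k) * (s * h $ k)))) (at y)"
  for y :: "real^'n::finite"
  by (auto intro!: derivative_eq_intros bounded_linear.has_derivative[OF bounded_linear_vec_nth]
      simp: algebra_simps)

text \<open>The factor \<open>c\<close> makes this family closed under differentiation, so the same
  formula yields first and second derivatives; \<open>c = 0\<close> covers the coordinates other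
  than \<open>k\<close>.\<close>

lemma pderiv_cl_exp_nth:
  assumes "x \<in> closure \<Omega>"
  shows "pderiv_cl \<Omega> j (\<lambda>y. c * exp (s * y $ k)) x = (if j = k then c * s else 0) * exp (s * x $ k)"
  by (rule pderiv_cl_eqI[OF has_derivative_exp_nth _ _ assms])
    (auto simp: axis_def intro!: continuous_intros)

lemma C1_closure_exp_nth: "C1_closure \<Omega> (\<lambda>y. c * exp (s * y $ k))"
  by (rule C1_closureI[OF _ has_derivative_exp_nth refl]) (intro continuous_intros)+

lemma C2_closure_exp_nth:
  assumes "open \<Omega>"
  shows "C2_closure \<Omega> (\<lambda>y. exp (s * y $ k))"
  unfolding C2_closure_def
proof (intro conjI allI)
  show "C1_closure \<Omega> (\<lambda>y. exp (s * y $ k))" using C1_closure_exp_nth[of \<Omega> 1 s k] by simp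
  show "C1_closure \<Omega> (pderiv_cl \<Omega> j (\<lambda>y. exp (s * y $ k)))" for j
    using pderiv_cl_exp_nth[of _ \<Omega> j 1 s k]
    by (intro C1_closure_cong[OF assms _ C1_closure_exp_nth[of _ "if j = k then s else 0" s k]]) simp
qed

section \<open>Uniform bounds and absorption of mixed terms\<close>

lemma unif_pos_def_diag_matrix_lower_bound:
  assumes "unif_pos_def S (diag_matrix a)"
  obtains c where "c > 0" "\<And>x i. x \<in> S \<Longrightarrow> a i x \<ge> c"
proof -
  obtain c where "c > 0" and c: "\<And>x \<xi>. x \<in> S \<Longrightarrow>
    (\<Sum>i\<in>UNIV. \<Sum>j\<in>UNIV. diag_matrix a x $ i $ j * \<xi> $ i * \<xi> $ j) \<ge> c * (norm \<xi>)\<^sup>2"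
    using assms unfolding unif_pos_def_def by blast
  have "a i x \<ge> c" if "x \<in> S" for x i
  proof -
    \<comment> \<open>Testing the form on a unit coordinate vector isolates one diagonal
      entry.\<close>
    have "(\<Sum>j\<in>UNIV. \<Sum>l\<in>UNIV. diag_matrix a x $ j $ l * axis i 1 $ j * axis i 1 $ l)
        = (\<Sum>j\<in>UNIV. if j = i then a i x else 0)"
      by (intro sum.cong refl) (simp add: diag_matrix_def axis_def if_distrib[of "\<lambda>z. _ * z"] cong: if_cong)
    then show ?thesis using c[OF that, of "axis i 1"] by (simp add: norm_axis_1)
  qed
  with \<open>c > 0\<close> show ?thesis using that by blast
qed

lemma uniform_upper_bound:
  fixes f :: "'i::finite \<Rightarrow> 'a::topological_space \<Rightarrow> real"
  assumes "compact K" and "\<And>i. continuous_on K (f i)"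
  obtains M where "M > 0" "\<And>i x. x \<in> K \<Longrightarrow> \<bar>f i x\<bar> \<le> M"
proof -
  have "compact (\<Union>i. f i ` K)" using assms by (intro compact_UN) (auto intro: compact_continuous_image)
  then obtain M where "M > 0" "\<And>z. z \<in> (\<Union>i. f i ` K) \<Longrightarrow> norm z \<le> M"
    using compact_imp_bounded bounded_pos by metis
  then show ?thesis by (intro that[of M]) auto
qed

lemma uniform_positive_lower_bound:
  fixes f :: "'i::finite \<Rightarrow> 'a::topological_space \<Rightarrow> real"
  assumes "compact K" and cont: "\<And>i. continuous_on K (f i)"
    and pos: "\<And>i x. i \<in> I \<Longrightarrow> x \<in> K \<Longrightarrow> f i x > 0"
  obtains m where "m > 0" "\<And>i x. i \<in> I \<Longrightarrow> x \<in> K \<Longrightarrow> f i x \<ge> m"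
proof -
  \<comment> \<open>Inserting 1 keeps the set nonempty with positive elements even if
    \<open>I\<close> is empty, as happens below in dimension one, where no index differs from
    \<open>k\<close>.\<close>
  define C where "C = insert 1 (\<Union>i\<in>I. f i ` K)"
  have "compact C" unfolding C_def using assms(1) cont
    by (intro compact_insert compact_UN) (auto intro: compact_continuous_image)
  then obtain m where "m \<in> C" "\<And>z. z \<in> C \<Longrightarrow> m \<le> z"
    using compact_attains_inf[of C] by (auto simp: C_def)
  then show ?thesis using pos by (intro that[of m]) (auto simp: C_def)
qed

text \<open>Young's inequality by completing a square. The weight is chosen so that only half of a
  coercive term \<open>\<delta> * c * x\<^sup>2\<close> is spent; the remaining cost falls on
  \<open>y\<close>.\<close>

lemma mixed_term_bound:
  fixes \<delta> c M b q x y :: real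
  assumes "\<delta> > 0" "c > 0" "\<bar>b\<bar> \<le> M" "\<bar>q\<bar> \<le> M"
  shows "2 * b * q * x * y \<ge> - (\<delta> * c / 2 * x\<^sup>2) - 2 * M^4 / (\<delta> * c) * y\<^sup>2"
proof -
  define e where "e = \<delta> * c"
  have e: "e > 0" using assms by (simp add: e_def)
  have "\<bar>b * q\<bar> \<le> M * M" unfolding abs_mult using assms by (intro mult_mono) auto
  then have "(b * q)\<^sup>2 \<le> (M * M)\<^sup>2" by (metis abs_ge_zero power2_abs power_mono)
  then have bq: "(b * q)\<^sup>2 \<le> M^4" by (simp add: power_mult_distrib flip: power_add)
  have "0 \<le> (e * x + 2 * (b * q) * y)\<^sup>2 / (2 * e)" using e by simp
  also have "\<dots> = e / 2 * x\<^sup>2 + 2 * b * q * x * y + 2 * (b * q)\<^sup>2 / e * y\<^sup>2"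
    using e by (simp add: field_simps power2_eq_square)
  also have "\<dots> \<le> e / 2 * x\<^sup>2 + 2 * b * q * x * y + 2 * M^4 / e * y\<^sup>2"
    using bq e by (intro add_left_mono mult_right_mono divide_right_mono) auto
  finally show ?thesis by (simp add: e_def)
qed

theorem theorem1p1:
  fixes \<Omega> :: "(real^'n::finite) set"
    and a :: "'n \<Rightarrow> real^'n \<Rightarrow> real"
    and A :: "real^'n \<Rightarrow> real^'n^'n"
  defines "A \<equiv> diag_matrix a"
  assumes "domain_set \<Omega>" and "bounded \<Omega>" and "C2_boundary \<Omega>"
    and "\<And>i. C1_closure \<Omega> (a i)"
    and "unif_pos_def (closure \<Omega>) A"
    and "\<exists>j0. (\<forall>i. i \<noteq> j0 \<longrightarrow> (\<forall>x\<in>closure \<Omega>. pderiv_cl \<Omega> j0 (a i) x > 0)) \<or>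
              (\<forall>i. i \<noteq> j0 \<longrightarrow> (\<forall>x\<in>closure \<Omega>. pderiv_cl \<Omega> j0 (a i) x < 0))"
  shows "\<exists>(d :: real^'n \<Rightarrow> real) (\<mu>0 :: real).
    C2_closure \<Omega> d \<and> \<mu>0 > 0 \<and>
    (\<forall>x\<in>closure \<Omega>. \<forall>\<xi> :: real^'n.
       (\<Sum>i\<in>UNIV. \<Sum>j\<in>UNIV.
          (\<Sum>i'\<in>UNIV. \<Sum>j'\<in>UNIV.
             2 * A x $ i $ j' * pderiv_cl \<Omega> j' (\<lambda>y. A y $ i' $ j * pderiv_cl \<Omega> i' d y) x
             - pderiv_cl \<Omega> j' (\<lambda>y. A y $ i $ j) x * A x $ i' $ j' * pderiv_cl \<Omega> i' d x)
          * \<xi> $ i * \<xi> $ j)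
       \<ge> \<mu>0 * (\<Sum>i\<in>UNIV. \<Sum>j\<in>UNIV. A x $ i $ j * \<xi> $ i * \<xi> $ j)) \<and>
    (\<forall>x\<in>closure \<Omega>. norm (gradient_cl \<Omega> d x) > 0)"
proof -
  have op: "open \<Omega>" using \<open>domain_set \<Omega>\<close> by (auto simp: domain_set_def)
  have K: "compact (closure \<Omega>)" using \<open>bounded \<Omega>\<close> by simp
  have C1: "C1_closure \<Omega> (a i)" for i by fact
  have contp: "continuous_on (closure \<Omega>) (pderiv_cl \<Omega> j (a i))"
    and conta: "continuous_on (closure \<Omega>) (a i)" for i j
    using C1 by (auto simp: C1_closure_def)
  obtain c where c: "c > 0" "\<And>x i. x \<in> closure \<Omega> \<Longrightarrow> a i x \<ge> c"
    using \<open>unif_pos_def (closure \<Omega>) A\<close> unif_pos_def_diag_matrix_lower_bound unfolding A_def by blast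
  obtain k \<sigma> where \<sigma>: "\<sigma> = 1 \<or> \<sigma> = (-1 :: real)"
    and sgn: "\<And>i x. i \<noteq> k \<Longrightarrow> x \<in> closure \<Omega> \<Longrightarrow> - \<sigma> * pderiv_cl \<Omega> k (a i) x > 0"
  proof -
    obtain k where "(\<forall>i. i \<noteq> k \<longrightarrow> (\<forall>x\<in>closure \<Omega>. pderiv_cl \<Omega> k (a i) x > 0)) \<or>
              (\<forall>i. i \<noteq> k \<longrightarrow> (\<forall>x\<in>closure \<Omega>. pderiv_cl \<Omega> k (a i) x < 0))"
      using assms(7) by blast
    then show ?thesis using that[of "-1" k] that[of 1 k] by auto
  qed

  \<comment> \<open>Choice of the constants and of the exponent\<close>
  obtain M1 where M1: "M1 > 0" "\<And>i x. x \<in> closure \<Omega> \<Longrightarrow> \<bar>a i x\<bar> \<le> M1"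
    using uniform_upper_bound[OF K, of a] conta by blast
  obtain M2 where M2: "M2 > 0" "\<And>i x. x \<in> closure \<Omega> \<Longrightarrow> \<bar>pderiv_cl \<Omega> i (a k) x\<bar> \<le> M2"
    using uniform_upper_bound[OF K, of "\<lambda>i. pderiv_cl \<Omega> i (a k)"] contp by blast
  define M where "M = max M1 M2"
  have M: "M > 0" "\<And>i x. x \<in> closure \<Omega> \<Longrightarrow> \<bar>a i x\<bar> \<le> M"
    "\<And>i x. x \<in> closure \<Omega> \<Longrightarrow> \<bar>pderiv_cl \<Omega> i (a k) x\<bar> \<le> M"
    using M1 M2 by (auto simp: M_def le_max_iff_disj)
  obtain \<delta> where \<delta>: "\<delta> > 0"
    "\<And>i x. i \<noteq> k \<Longrightarrow> x \<in> closure \<Omega> \<Longrightarrow> - \<sigma> * pderiv_cl \<Omega> k (a i) x \<ge> \<delta>"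
  proof (rule uniform_positive_lower_bound[OF K])
    show "continuous_on (closure \<Omega>) (\<lambda>x. - \<sigma> * pderiv_cl \<Omega> k (a i) x)" for i
      by (intro continuous_intros contp)
    show "- \<sigma> * pderiv_cl \<Omega> k (a i) x > 0" if "i \<in> - {k}" "x \<in> closure \<Omega>" for i x
      using sgn that by blast
  qed blast
  define L where "L = 2 * M^4 / (\<delta> * c)"
  define N where "N = real CARD('n)"
  \<comment> \<open>\<open>\<tau>\<close> is the size of \<open>s\<close>. Its three summands pay
    for the term with the \<open>k\<close>-th derivative of \<open>a k\<close>, for a cost
    \<open>L\<close> per index from the mixed terms, and for the coercivity wanted in
    \<open>\<xi> $ k\<close>; \<open>c\<^sup>2\<close> bounds the square of \<open>a k\<close> from
    below.\<close>
  define \<tau> where "\<tau> = (M\<^sup>2 + N * L + \<delta> * c / 2) / (2 * c\<^sup>2)"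
  have L: "L \<ge> 0" using \<delta> c by (simp add: L_def)
  have "M\<^sup>2 + N * L + \<delta> * c / 2 > 0" using L M \<delta> c by (intro add_nonneg_pos add_nonneg_nonneg) (auto simp: N_def)
  then have \<tau>: "\<tau> > 0" "2 * \<tau> * c\<^sup>2 = M\<^sup>2 + N * L + \<delta> * c / 2"
    using c by (auto simp: \<tau>_def)
  define s where "s = \<sigma> * \<tau>"
  define d where "d = (\<lambda>y :: real^'n. exp (s * y $ k))"
  define F where "F = (\<lambda>x :: real^'n. \<tau> * exp (s * x $ k))"
  have Fpos: "F x > 0" for x using \<tau> by (simp add: F_def)
  have ss: "s * s = \<tau> * \<tau>" using \<sigma> by (auto simp: s_def)
  obtain F0 where F0: "F0 > 0" "\<And>x. x \<in> closure \<Omega> \<Longrightarrow> F x \<ge> F0"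
  proof (rule uniform_positive_lower_bound[OF K, of "\<lambda>_::unit. F" UNIV])
    show "continuous_on (closure \<Omega>) F" unfolding F_def by (intro continuous_intros)
  qed (use Fpos in blast)+

  \<comment> \<open>Derivatives of the weight and of its products with the matrix entries\<close>
  have pd: "pderiv_cl \<Omega> i d x = (if i = k then s else 0) * exp (s * x $ k)" if "x \<in> closure \<Omega>" for i x
    using pderiv_cl_exp_nth[OF that, of i 1 s k] by (simp add: d_def)
  have pd': "pderiv_cl \<Omega> i d x = (if i = k then \<sigma> * F x else 0)" if "x \<in> closure \<Omega>" for i x
    using pd[OF that] by (simp add: F_def s_def)
  have Aij: "A y $ i $ j = (if i = j then a i y else 0)" for y i j
    by (simp add: A_def diag_matrix_def)
  have pA: "pderiv_cl \<Omega> j' (\<lambda>y. A y $ i $ j) x = (if i = j then pderiv_cl \<Omega> j' (a i) x else 0)"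
    if "x \<in> closure \<Omega>" for x i j j'
    using pderiv_cl_zero[OF that] by (simp add: Aij)
  \<comment> \<open>Diagonality forces \<open>i = j\<close>, and dependence of \<open>d\<close> on
    one coordinate forces \<open>i = k\<close>. The second derivative of \<open>d\<close>
    contributes \<open>\<tau> * F x\<close>, since the sign of \<open>s\<close> squares
    away.\<close>
  have pAd: "pderiv_cl \<Omega> j' (\<lambda>y. A y $ i $ j * pderiv_cl \<Omega> i d y) x =
      (if i = j \<and> i = k then pderiv_cl \<Omega> j' (a k) x * (\<sigma> * F x) +
         (if j' = k then a k x * (\<tau> * F x) else 0) else 0)" if x: "x \<in> closure \<Omega>" for x i j j'
  proof (cases "i = j \<and> i = k")
    case True
    have "pderiv_cl \<Omega> j' (\<lambda>y. A y $ i $ j * pderiv_cl \<Omega> i d y) x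
        = pderiv_cl \<Omega> j' (\<lambda>y. a k y * (s * exp (s * y $ k))) x"
      using True closure_subset[of \<Omega>] by (intro pderiv_cl_cong[OF op]) (auto simp: Aij pd)
    also have "\<dots> = a k x * pderiv_cl \<Omega> j' (\<lambda>y. s * exp (s * y $ k)) x
        + pderiv_cl \<Omega> j' (a k) x * (s * exp (s * x $ k))"
      by (rule pderiv_cl_mult[OF C1 C1_closure_exp_nth x])
    also have "\<dots> = a k x * (if j' = k then \<tau> * F x else 0) + pderiv_cl \<Omega> j' (a k) x * (\<sigma> * F x)"
      unfolding pderiv_cl_exp_nth[OF x] ss by (simp add: F_def s_def)
    finally show ?thesis using True by auto
  next
    case False
    have "pderiv_cl \<Omega> j' (\<lambda>y. A y $ i $ j * pderiv_cl \<Omega> i d y) x = pderiv_cl \<Omega> j' (\<lambda>y. 0) x"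
      using False closure_subset[of \<Omega>] by (intro pderiv_cl_cong[OF op]) (auto simp: Aij pd)
    then show ?thesis using False pderiv_cl_zero[OF x] by auto
  qed
  \<comment> \<open>Least weight times the coercivity constant, divided by \<open>M\<close> to pass
    from the squared norm of \<open>\<xi>\<close> to the form of \<open>A\<close>.\<close>
  define \<mu> where "\<mu> = F0 * (\<delta> * c / 2) / M"
  have \<mu>: "\<mu> > 0" using F0 \<delta> c M by (simp add: \<mu>_def)

  \<comment> \<open>Reduction and estimate of the quadratic form\<close>
  have main: "(\<Sum>i\<in>UNIV. \<Sum>j\<in>UNIV.
          (\<Sum>i'\<in>UNIV. \<Sum>j'\<in>UNIV.
             2 * A x $ i $ j' * pderiv_cl \<Omega> j' (\<lambda>y. A y $ i' $ j * pderiv_cl \<Omega> i' d y) x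
             - pderiv_cl \<Omega> j' (\<lambda>y. A y $ i $ j) x * A x $ i' $ j' * pderiv_cl \<Omega> i' d x)
          * \<xi> $ i * \<xi> $ j)
       \<ge> \<mu> * (\<Sum>i\<in>UNIV. \<Sum>j\<in>UNIV. A x $ i $ j * \<xi> $ i * \<xi> $ j)"
    (is "?Q \<ge> \<mu> * ?R") if x: "x \<in> closure \<Omega>" for x and \<xi> :: "real^'n"
  proof -
    define T where "T i = (2 * a i x * (\<sigma> * pderiv_cl \<Omega> i (a k) x) +
      (if i = k then 2 * a k x * (a k x * \<tau>) else 0)) * \<xi> $ i * \<xi> $ k
      + (- \<sigma> * pderiv_cl \<Omega> k (a i) x) * a k x * (\<xi> $ i)\<^sup>2" for i
    have S: "(\<Sum>i'\<in>UNIV. \<Sum>j'\<in>UNIV.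
             2 * A x $ i $ j' * pderiv_cl \<Omega> j' (\<lambda>y. A y $ i' $ j * pderiv_cl \<Omega> i' d y) x
             - pderiv_cl \<Omega> j' (\<lambda>y. A y $ i $ j) x * A x $ i' $ j' * pderiv_cl \<Omega> i' d x)
      = (if j = k then 2 * a i x * (pderiv_cl \<Omega> i (a k) x * (\<sigma> * F x) +
            (if i = k then a k x * (\<tau> * F x) else 0)) else 0)
        - (if i = j then pderiv_cl \<Omega> k (a i) x * a k x * (\<sigma> * F x) else 0)" (is "?l = ?r") for i j
    proof -
      let ?B = "\<lambda>j'. pderiv_cl \<Omega> j' (a k) x * (\<sigma> * F x) + (if j' = k then a k x * (\<tau> * F x) else 0)"
      let ?C = "\<lambda>j'. if i = j then pderiv_cl \<Omega> j' (a i) x else 0"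
      \<comment> \<open>Nested conditionals, each testing one summation index, let both sums
        collapse as Kronecker deltas.\<close>
      have "?l = (\<Sum>i'\<in>UNIV. \<Sum>j'\<in>UNIV.
          (if j' = i then if i' = j then if j = k then 2 * a i x * ?B i else 0 else 0 else 0)
          - (if j' = i' then if i' = k then ?C k * a k x * (\<sigma> * F x) else 0 else 0))"
        unfolding pAd[OF x] pA[OF x] pd'[OF x] by (intro sum.cong refl) (auto simp: Aij)
      also have "\<dots> = (if j = k then 2 * a i x * ?B i else 0) - ?C k * a k x * (\<sigma> * F x)"
        by (simp add: sum_subtractf)
      finally show ?thesis by simp
    qed
    have "?Q = (\<Sum>i\<in>UNIV. F x * T i)"
    proof (intro sum.cong refl)
      fix i :: 'n
      let ?G = "2 * a i x * (pderiv_cl \<Omega> i (a k) x * (\<sigma> * F x) +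
            (if i = k then a k x * (\<tau> * F x) else 0))"
      let ?H = "pderiv_cl \<Omega> k (a i) x * a k x * (\<sigma> * F x)"
      have "(\<Sum>j\<in>UNIV. ((if j = k then ?G else 0) - (if i = j then ?H else 0)) * \<xi> $ i * \<xi> $ j)
        = (\<Sum>j\<in>UNIV. (if j = k then ?G * \<xi> $ i * \<xi> $ k else 0) - (if j = i then ?H * \<xi> $ i * \<xi> $ i else 0))"
        by (intro sum.cong refl) (simp add: algebra_simps)
      also have "\<dots> = ?G * \<xi> $ i * \<xi> $ k - ?H * \<xi> $ i * \<xi> $ i"
        by (simp only: sum_subtractf sum.delta finite UNIV_I if_True)
      also have "\<dots> = F x * T i" by (simp add: T_def algebra_simps power2_eq_square)
      finally show "(\<Sum>j\<in>UNIV. (\<Sum>i'\<in>UNIV. \<Sum>j'\<in>UNIV.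
             2 * A x $ i $ j' * pderiv_cl \<Omega> j' (\<lambda>y. A y $ i' $ j * pderiv_cl \<Omega> i' d y) x
             - pderiv_cl \<Omega> j' (\<lambda>y. A y $ i $ j) x * A x $ i' $ j' * pderiv_cl \<Omega> i' d x)
          * \<xi> $ i * \<xi> $ j) = F x * T i" by (simp only: S)
    qed
    then have Q: "?Q = F x * (\<Sum>i\<in>UNIV. T i)" by (simp only: sum_distrib_left)
    \<comment> \<open>The loss with factor \<open>L\<close> is charged to every index, including
      \<open>k\<close>, so that over all \<open>N\<close> indices it cancels exactly against the
      gain at \<open>k\<close>.\<close>
    have T: "T i \<ge> \<delta> * c / 2 * (\<xi> $ i)\<^sup>2 - L * (\<xi> $ k)\<^sup>2 + (if i = k then N * L * (\<xi> $ k)\<^sup>2 else 0)" for i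
    proof (cases "i = k")
      case True
      have 1: "c\<^sup>2 \<le> (a k x)\<^sup>2" using c x by (intro power_mono) auto
      \<comment> \<open>At \<open>i = k\<close> the mixed term is itself a multiple of
        \<open>(\<xi> $ k)\<^sup>2\<close>; its factor 2 minus the 1 from the last term of
        \<open>T\<close> leaves one copy of this product.\<close>
      have "\<bar>\<sigma> * a k x * pderiv_cl \<Omega> k (a k) x\<bar> \<le> M * M"
        using \<sigma> M x by (auto simp: abs_mult intro!: mult_mono)
      then have "- M\<^sup>2 \<le> \<sigma> * a k x * pderiv_cl \<Omega> k (a k) x" by (simp add: power2_eq_square)
      moreover have "2 * \<tau> * c\<^sup>2 \<le> 2 * \<tau> * (a k x)\<^sup>2" using 1 \<tau>(1) by simp
      ultimately have "N * L + \<delta> * c / 2 \<le> 2 * \<tau> * (a k x)\<^sup>2 + \<sigma> * a k x * pderiv_cl \<Omega> k (a k) x"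
        using \<tau>(2) by linarith
      then have "(N * L + \<delta> * c / 2 - L) * (\<xi> $ k)\<^sup>2
          \<le> (2 * \<tau> * (a k x)\<^sup>2 + \<sigma> * a k x * pderiv_cl \<Omega> k (a k) x) * (\<xi> $ k)\<^sup>2"
        using L by (intro mult_right_mono) auto
      then show ?thesis using True by (simp add: T_def algebra_simps power2_eq_square)
    next
      case False
      have "\<bar>\<sigma> * pderiv_cl \<Omega> i (a k) x\<bar> \<le> M" using \<sigma> M x by (auto simp: abs_mult)
      then have 1: "2 * a i x * (\<sigma> * pderiv_cl \<Omega> i (a k) x) * \<xi> $ i * \<xi> $ k
          \<ge> - (\<delta> * c / 2 * (\<xi> $ i)\<^sup>2) - L * (\<xi> $ k)\<^sup>2"
        using mixed_term_bound[OF \<delta>(1) c(1) M(2)[OF x]] unfolding L_def by blast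
      \<comment> \<open>The sign hypothesis enters here: this coefficient is coercive, and half of
        it absorbs the mixed term.\<close>
      have "\<delta> * c \<le> (- \<sigma> * pderiv_cl \<Omega> k (a i) x) * a k x"
        using \<delta>(2)[OF False x] \<delta>(1) c x by (intro mult_mono) auto
      then have "\<delta> * c * (\<xi> $ i)\<^sup>2 \<le> (- \<sigma> * pderiv_cl \<Omega> k (a i) x) * a k x * (\<xi> $ i)\<^sup>2"
        by (intro mult_right_mono) auto
      then show ?thesis using 1 False by (simp add: T_def)
    qed
    let ?X = "\<Sum>i\<in>UNIV. (\<xi> $ i)\<^sup>2"
    have X: "?X \<ge> 0" by (simp add: sum_nonneg)
    have "\<delta> * c / 2 * ?X
        = (\<Sum>i\<in>UNIV. \<delta> * c / 2 * (\<xi> $ i)\<^sup>2 - L * (\<xi> $ k)\<^sup>2 + (if i = k then N * L * (\<xi> $ k)\<^sup>2 else 0))"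
      by (simp add: sum.distrib sum_subtractf sum_distrib_left N_def)
    also have "\<dots> \<le> (\<Sum>i\<in>UNIV. T i)" using T by (intro sum_mono)
    finally have sumT: "\<delta> * c / 2 * ?X \<le> (\<Sum>i\<in>UNIV. T i)" .
    have "?R = (\<Sum>i\<in>UNIV. a i x * (\<xi> $ i)\<^sup>2)"
      by (simp add: Aij if_distrib[of "\<lambda>z. z * _"] power2_eq_square mult.assoc cong: if_cong)
    also have "\<dots> \<le> (\<Sum>i\<in>UNIV. M * (\<xi> $ i)\<^sup>2)"
      using M(2)[OF x] by (intro sum_mono mult_right_mono) (auto simp: abs_le_iff)
    finally have "\<mu> * ?R \<le> \<mu> * (M * ?X)" 
      using \<mu> by (intro mult_left_mono) (simp_all flip: sum_distrib_left)
    also have "\<dots> = F0 * (\<delta> * c / 2 * ?X)" using M(1) by (simp add: \<mu>_def)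
    also have "\<dots> \<le> F x * (\<Sum>i\<in>UNIV. T i)"
      using F0 x sumT X \<delta> c Fpos[of x] by (intro mult_mono) (auto intro: less_imp_le)
    finally show ?thesis using Q by simp
  qed
  have "norm (gradient_cl \<Omega> d x) > 0" if "x \<in> closure \<Omega>" for x
  proof -
    have "gradient_cl \<Omega> d x $ k \<noteq> 0"
      using pd'[OF that, of k] Fpos[of x] \<sigma> by (auto simp: gradient_cl_def)
    then show ?thesis by auto
  qed
  then show ?thesis using main \<mu> C2_closure_exp_nth[OF op, of s k] unfolding d_def[symmetric] by blast
qed

end
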